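(* Let $\mathbb{G}$ be a stratified group with $N\geq2$ being the dimension of the first stratum, and let $\alpha, \beta\in \mathbb{R}$. Then for all complex-valued functions $f\in C_{0}^{\infty}(\mathbb{G}\backslash\{x'=0\})$ we have $$\|\mathcal{L} f\|^{2}_{L^{2}(\mathbb{G})}\geq (\alpha(N-2)-2\beta)\left\|\frac{\nabla_{H} f}{|x'|}\right\|^{2}_{L^{2}(\mathbb{G})}-\alpha^{2}\left\|\frac{x'\cdot\nabla_{H} f}{|x'|^{2}}\right\|^{2}_{L^{2}(\mathbb{G})}$$ $$+\big(\alpha(N-4)(N-2)-\alpha^{2}(N-2)+2\beta(4-N)-\beta^{2}+\alpha\beta(N-2)\big)\left\|\frac{f}{|x'|^{2}}\right\|^{2}_{L^{2}(\mathbb{G})}.$$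
   Context: A stratified group (homogeneous Carnot group) is a triple $\mathbb{G}=(\mathbb{R}^{n},\circ,D_{\lambda})$, where $(\mathbb{R}^n,\circ)$ is a Lie group with identity $0$, such that: (i) for some natural numbers $N=N_1,N_2,\ldots,N_r$ with $N+N_2+\cdots+N_r=n$ one has $\mathbb{R}^{n}=\mathbb{R}^{N}\times\mathbb{R}^{N_2}\times\cdots\times\mathbb{R}^{N_r}$ and, for each $\lambda>0$, the dilation $D_{\lambda}(x',x^{(2)},\ldots,x^{(r)})=(\lambda x',\lambda^{2}x^{(2)},\ldots,\lambda^{r}x^{(r)})$, with $x'\in\mathbb{R}^N$, $x^{(k)}\in\mathbb{R}^{N_k}$, is an automorphism of $\mathbb{G}$; (ii) if $X_1,\ldots,X_N$ are the left invariant vector fields on $\mathbb{G}$ with $X_k(0)=\frac{\partial}{\partial x_k}|_0$ for $k=1,\ldots,N$, then $\mathrm{rank}(\mathrm{Lie}\{X_1,\ldots,X_N\})=n$ at every $x\in\mathbb{R}^n$. $N$ is the dimension of the first stratum. Notation: $\nabla_H=(X_1,\ldots,X_N)$ is the horizontal gradient; $\mathcal{L}=\sum_{k=1}^N X_k^2$ is the sub-Laplacian; $|x'|=\sqrt{x_1'^2+\cdots+x_N'^2}$ is the Euclidean norm on $\mathbb{R}^N$; $x'\cdot\nabla_H f=\sum_{k=1}^N x'_kX_kf$; $|\nabla_H f|^2=\sum_{k=1}^N|X_kf|^2$. $L^2(\mathbb{G})$ is taken with respect to Haar measure, which is Lebesgue measure on $\mathbb{R}^n$. $C_0^\infty(\mathbb{G}\backslash\{x'=0\})$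 denotes smooth functions compactly supported in $\{x\in\mathbb{G}:x'\neq0\}$. *)

theory Defs
  imports "HOL-Analysis.Analysis"
begin

primrec C_k :: "nat \<Rightarrow> ('a::euclidean_space \<Rightarrow> 'b::real_normed_vector) \<Rightarrow> bool" where
  "C_k 0 f \<longleftrightarrow> continuous_on UNIV f"
| "C_k (Suc k) f \<longleftrightarrow> f differentiable_on UNIV \<and>
     (\<forall>b\<in>Basis. C_k k (\<lambda>x. frechet_derivative f (at x) b))"

definition smooth :: "('a::euclidean_space \<Rightarrow> 'b::real_normed_vector) \<Rightarrow> bool" where
  "smooth f \<longleftrightarrow> (\<forall>k. C_k k f)"

text \<open>Functions that are smooth with compact support in the open set \<open>\<Omega>\<close> are identified with
  their extensions by zero to the whole space.\<close>

definition test_function :: "'a::euclidean_space set \<Rightarrow> ('a \<Rightarrow> 'b::real_normed_vector) \<Rightarrow> bool" where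
  "test_function \<Omega> f \<longleftrightarrow>
     smooth f \<and> compact (closure {x. f x \<noteq> 0}) \<and> closure {x. f x \<noteq> 0} \<subseteq> \<Omega>"

definition L2_norm :: "('a::euclidean_space \<Rightarrow> 'b::real_normed_vector) \<Rightarrow> real" where
  "L2_norm g = sqrt (LINT x|lborel. (norm (g x))\<^sup>2)"


section \<open>Vector fields\<close>

text \<open>A vector field \<open>X = (\<Sum>i. a\<^sub>i \<partial>\<^sub>i)\<close> is represented by its coefficient function
  \<open>x \<mapsto> (a\<^sub>i x)\<^sub>i\<close>.\<close>

definition field_deriv ::
    "('a::euclidean_space \<Rightarrow> 'a) \<Rightarrow> ('a \<Rightarrow> 'b::real_normed_vector) \<Rightarrow> 'a \<Rightarrow> 'b" where
  "field_deriv X f x = frechet_derivative f (at x) (X x)"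

definition lie_bracket ::
    "('a::euclidean_space \<Rightarrow> 'a) \<Rightarrow> ('a \<Rightarrow> 'a) \<Rightarrow> 'a \<Rightarrow> 'a" where
  "lie_bracket X Y = (\<lambda>x. field_deriv X Y x - field_deriv Y X x)"

inductive_set lie_algebra_gen ::
    "('a::euclidean_space \<Rightarrow> 'a) set \<Rightarrow> ('a \<Rightarrow> 'a) set" for G where
  gen: "X \<in> G \<Longrightarrow> X \<in> lie_algebra_gen G"
| zero: "(\<lambda>x. 0) \<in> lie_algebra_gen G"
| add: "\<lbrakk>X \<in> lie_algebra_gen G; Y \<in> lie_algebra_gen G\<rbrakk> \<Longrightarrow> (\<lambda>x. X x + Y x) \<in> lie_algebra_gen G"
| scale: "X \<in> lie_algebra_gen G \<Longrightarrow> (\<lambda>x. c *\<^sub>R X x) \<in> lie_algebra_gen G"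
| bracket: "\<lbrakk>X \<in> lie_algebra_gen G; Y \<in> lie_algebra_gen G\<rbrakk> \<Longrightarrow> lie_bracket X Y \<in> lie_algebra_gen G"


section \<open>Stratified groups\<close>

locale euclidean_lie_group = group mul 0 iv
  for mul :: "real^'n \<Rightarrow> real^'n \<Rightarrow> real^'n" and iv :: "real^'n \<Rightarrow> real^'n" +
  assumes smooth_mul: "smooth (\<lambda>(x, y). mul x y)"
    and smooth_inverse: "smooth iv"

definition lie_automorphism ::
    "(real^'n \<Rightarrow> real^'n \<Rightarrow> real^'n) \<Rightarrow> (real^'n \<Rightarrow> real^'n) \<Rightarrow> bool" where
  "lie_automorphism mul \<phi> \<longleftrightarrow> bij \<phi> \<and> smooth \<phi> \<and> smooth (inv \<phi>) \<and>
     (\<forall>x y. \<phi> (mul x y) = mul (\<phi> x) (\<phi> y))"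

definition left_invariant ::
    "(real^'n \<Rightarrow> real^'n \<Rightarrow> real^'n) \<Rightarrow> (real^'n \<Rightarrow> real^'n) \<Rightarrow> bool" where
  "left_invariant mul X \<longleftrightarrow> smooth X \<and>
     (\<forall>x y. frechet_derivative (mul x) (at y) (X y) = X (mul x y))"

text \<open>The decomposition of \<open>\<real>\<^sup>n\<close> into strata is given by a weight function \<open>w\<close> on the coordinate
  indices: the coordinates of the \<open>k\<close>-th factor are those of weight \<open>k\<close>, so that
  \<open>N\<^sub>k = card {i. w i = k}\<close>. The order of the coordinates plays no role.\<close>

definition dilation :: "('n::finite \<Rightarrow> nat) \<Rightarrow> real \<Rightarrow> real^'n \<Rightarrow> real^'n" where
  "dilation w l x = (\<chi> i. l ^ w i * x $ i)"

definition first_stratum :: "('n::finite \<Rightarrow> nat) \<Rightarrow> 'n set" where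
  "first_stratum w = {i. w i = 1}"

definition horizontal_frame :: "(real^'n \<Rightarrow> real^'n \<Rightarrow> real^'n) \<Rightarrow> ('n::finite \<Rightarrow> nat)
    \<Rightarrow> ('n \<Rightarrow> real^'n \<Rightarrow> real^'n) \<Rightarrow> bool" where
  "horizontal_frame mul w X \<longleftrightarrow>
     (\<forall>k\<in>first_stratum w. left_invariant mul (X k) \<and> X k 0 = axis k 1)"

text \<open>On \<^term>\<open>first_stratum w\<close> the horizontal frame exists and is unique, so that the quantifier
  in the rank condition only names it.\<close>

locale stratified_group = euclidean_lie_group mul iv
  for mul :: "real^'n \<Rightarrow> real^'n \<Rightarrow> real^'n" and iv :: "real^'n \<Rightarrow> real^'n"
    and w :: "'n::finite \<Rightarrow> nat" and r :: nat +
  assumes strata: "range w = {1..r}"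
    and dilation_automorphism: "l > 0 \<Longrightarrow> lie_automorphism mul (dilation w l)"
    and rank_condition: "horizontal_frame mul w X \<Longrightarrow>
      dim {Z x |Z. Z \<in> lie_algebra_gen (X ` first_stratum w)} = CARD('n)"


section \<open>Horizontal operators\<close>

text \<open>The space \<open>\<real>\<^sup>N\<close> (respectively \<open>\<complex>\<^sup>N\<close>) is identified with the vectors whose coordinates outside
  the first stratum vanish; \<^const>\<open>norm\<close> is its Euclidean norm.\<close>

definition proj1 :: "('n::finite \<Rightarrow> nat) \<Rightarrow> real^'n \<Rightarrow> real^'n" where
  "proj1 w x = (\<chi> k. if k \<in> first_stratum w then x $ k else 0)"

definition hgrad :: "('n::finite \<Rightarrow> nat) \<Rightarrow> ('n \<Rightarrow> real^'n \<Rightarrow> real^'n) \<Rightarrow> (real^'n \<Rightarrow> complex)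
    \<Rightarrow> real^'n \<Rightarrow> complex^'n" where
  "hgrad w X f x = (\<chi> k. if k \<in> first_stratum w then field_deriv (X k) f x else 0)"

definition radial_hderiv :: "('n::finite \<Rightarrow> nat) \<Rightarrow> ('n \<Rightarrow> real^'n \<Rightarrow> real^'n)
    \<Rightarrow> (real^'n \<Rightarrow> complex) \<Rightarrow> real^'n \<Rightarrow> complex" where
  "radial_hderiv w X f x = (\<Sum>k\<in>first_stratum w. of_real (x $ k) * field_deriv (X k) f x)"

definition sub_laplacian :: "('n::finite \<Rightarrow> nat) \<Rightarrow> ('n \<Rightarrow> real^'n \<Rightarrow> real^'n)
    \<Rightarrow> (real^'n \<Rightarrow> complex) \<Rightarrow> real^'n \<Rightarrow> complex" where
  "sub_laplacian w X f x = (\<Sum>k\<in>first_stratum w. field_deriv (X k) (field_deriv (X k) f) x)"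

end

theory Submission
  imports Defs
begin

text \<open>
  Write \<open>\<rho> = |x'|\<close>, \<open>R f = x' \<cdot> \<nabla>\<^sub>H f\<close> and \<open>\<L>\<close> for the sub-Laplacian. The inequality is the expanded form of

  \<open>\<parallel>\<L> f - \<alpha> R f/\<rho>\<^sup>2 - \<beta> f/\<rho>\<^sup>2\<parallel>\<^sup>2 + \<parallel>\<L> f + \<alpha> R f/\<rho>\<^sup>2 - (\<beta> - \<alpha>(N-2)) f/\<rho>\<^sup>2\<parallel>\<^sup>2 \<ge> 0\<close>.

  The two operators are formal adjoints of each other. What matters is that \<open>\<alpha> R\<close> enters them
  with opposite signs: on expanding the squares the cross term \<open>Re \<langle>\<L> f, R f/\<rho>\<^sup>2\<rangle>\<close> cancels. Evaluated
  on its own, it would bring in the commutators \<open>[X\<^sub>j, X\<^sub>k]\<close>, which have no sign. The remaining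
  cross terms \<open>Re \<langle>\<L> f, f/\<rho>\<^sup>2\<rangle>\<close> and \<open>Re \<langle>R f/\<rho>\<^sup>2, f/\<rho>\<^sup>2\<rangle>\<close> reduce to the three norms in the statement
  by one integration by parts each (\<open>integral_inner_sub_laplacian\<close>, \<open>integral_inner_radial\<close>).

  These integrations by parts need two properties of the fields \<open>X\<^sub>k\<close>. First,
  \<open>X\<^sub>k x\<^sub>j = \<delta>\<^sub>j\<^sub>k\<close> for coordinates of the first stratum (\<open>horizontal_coordinate\<close>), so that on functions
  of \<open>x'\<close> they act like the Euclidean \<open>\<partial>\<^sub>k\<close>. Secondly, \<open>X\<^sub>k\<close> is divergence free
  (\<open>horizontal_divergence_free\<close>), so that it integrates to zero against Lebesgue measure. Both
  follow from homogeneity: the \<open>i\<close>-th coefficient of \<open>X\<^sub>k\<close> is homogeneous of degree \<open>w i - 1\<close> under the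
  dilations. For \<open>w i = 1\<close> it is of degree \<open>0\<close> and continuous at the origin, hence constant; and its
  derivative along \<open>x\<^sub>i\<close> has degree \<open>-1\<close> and is continuous at the origin, hence zero.
\<close>

section \<open>Calculus of \<open>C\<^sup>k\<close> functions and vector fields\<close>

lemma C_k_frechet_derivative:
  assumes "C_k (Suc n) f"
  shows "(f has_derivative frechet_derivative f (at x)) (at x)"
  using assms by (simp add: differentiable_on_def frechet_derivative_works[symmetric])

lemma C_k_SucI:
  assumes "\<And>x. (f has_derivative F x) (at x)"
    and "\<And>b. b \<in> Basis \<Longrightarrow> C_k n (\<lambda>x. F x b)"
  shows "C_k (Suc n) f"
proof -
  have "frechet_derivative f (at x) = F x" for x
    using frechet_derivative_at[OF assms(1)] by simp
  moreover have "f differentiable (at x)" for x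
    using assms(1) differentiable_def by blast
  ultimately show ?thesis
    using assms(2) by (simp add: differentiable_on_def)
qed

lemma C_k_mono: "C_k (Suc n) f \<Longrightarrow> C_k n f"
proof (induction n arbitrary: f)
  case 0
  then show ?case by (simp add: differentiable_imp_continuous_on)
next
  case (Suc n)
  then show ?case by (simp only: C_k.simps(2)) blast
qed

lemma C_k_imp_continuous_on: "C_k n f \<Longrightarrow> continuous_on UNIV f"
  by (induction n) (auto simp: differentiable_imp_continuous_on)

lemma C_k_zero: "C_k n (\<lambda>x. 0)"
  by (induction n) (simp, simp add: differentiable_on_def)

lemma C_k_const: "C_k n (\<lambda>x. c)"
proof (cases n)
  case 0
  then show ?thesis by simp
next
  case (Suc m)
  show ?thesis
    unfolding Suc by (rule C_k_SucI[OF has_derivative_const]) (rule C_k_zero)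
qed

lemma C_k_add: "C_k n f \<Longrightarrow> C_k n g \<Longrightarrow> C_k n (\<lambda>x. f x + g x)"
proof (induction n arbitrary: f g)
  case 0
  then show ?case by (simp add: continuous_on_add)
next
  case (Suc n)
  show ?case
    by (rule C_k_SucI[OF has_derivative_add[OF C_k_frechet_derivative[OF Suc.prems(1)]
          C_k_frechet_derivative[OF Suc.prems(2)]]])
      (use Suc in simp)
qed

lemma C_k_sum: "(\<And>i. i \<in> I \<Longrightarrow> C_k n (f i)) \<Longrightarrow> C_k n (\<lambda>x. \<Sum>i\<in>I. f i x)"
  by (induction I rule: infinite_finite_induct) (auto simp: C_k_zero C_k_add)

lemma (in bounded_bilinear) C_k:
  "C_k n f \<Longrightarrow> C_k n g \<Longrightarrow> C_k n (\<lambda>x. prod (f x) (g x))"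
proof (induction n arbitrary: f g)
  case 0
  then show ?case by (simp add: continuous_on)
next
  case (Suc n)
  show ?case
    by (rule C_k_SucI[OF FDERIV[OF C_k_frechet_derivative[OF Suc.prems(1)]
          C_k_frechet_derivative[OF Suc.prems(2)]]])
      (use Suc.IH Suc.prems C_k_mono[OF Suc.prems(1)] C_k_mono[OF Suc.prems(2)] in
        \<open>simp add: C_k_add\<close>)
qed

lemmas C_k_mult = bounded_bilinear.C_k[OF bounded_bilinear_mult]
lemmas C_k_scaleR = bounded_bilinear.C_k[OF bounded_bilinear_scaleR]
lemmas C_k_inner = bounded_bilinear.C_k[OF bounded_bilinear_inner]

lemma C_k_bounded_linear:
  fixes L :: "'a::euclidean_space \<Rightarrow> 'b::real_normed_vector"
  assumes "bounded_linear L"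
  shows "C_k n L"
proof (cases n)
  case 0
  then show ?thesis using assms by (simp add: linear_continuous_on)
next
  case (Suc m)
  have "C_k (Suc m) L"
    by (rule C_k_SucI[OF bounded_linear_imp_has_derivative[OF assms]]) (rule C_k_const)
  then show ?thesis using Suc by simp
qed

text \<open>The coordinate form turns regularity of \<^term>\<open>field_deriv X f\<close> into regularity of products of
  coefficients of \<open>X\<close> with partial derivatives of \<open>f\<close>.\<close>
lemma field_deriv_Basis:
  assumes "C_k (Suc n) f"
  shows "field_deriv X f x = (\<Sum>b\<in>Basis. (X x \<bullet> b) *\<^sub>R frechet_derivative f (at x) b)"
proof -
  have L: "linear (frechet_derivative f (at x))"
    using C_k_frechet_derivative[OF assms] has_derivative_linear by blast
  show ?thesis
    unfolding field_deriv_def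
    by (subst (1) euclidean_representation[of "X x", symmetric])
      (simp add: linear_sum[OF L] linear_scale[OF L])
qed

lemma C_k_field_deriv:
  assumes "C_k n X" "C_k (Suc n) f"
  shows "C_k n (field_deriv X f)"
proof -
  have "C_k n (\<lambda>x. \<Sum>b\<in>Basis. (X x \<bullet> b) *\<^sub>R frechet_derivative f (at x) b)"
    using assms by (intro C_k_sum C_k_scaleR C_k_inner C_k_const) auto
  then show ?thesis
    by (simp add: field_deriv_Basis[OF assms(2), abs_def])
qed

lemma field_deriv_eqI: "(f has_derivative F) (at x) \<Longrightarrow> field_deriv X f x = F (X x)"
  unfolding field_deriv_def using frechet_derivative_at by metis

lemma (in bounded_bilinear) field_deriv:
  assumes "C_k (Suc n) f" "C_k (Suc m) g"
  shows "field_deriv X (\<lambda>x. prod (f x) (g x)) x =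
    prod (f x) (field_deriv X g x) + prod (field_deriv X f x) (g x)"
  by (subst field_deriv_eqI[OF FDERIV[OF C_k_frechet_derivative[OF assms(1)]
          C_k_frechet_derivative[OF assms(2)]]]) (simp add: field_deriv_def)

lemma frechet_derivative_eq_0_off_support:
  assumes "closed K" "\<And>x. x \<notin> K \<Longrightarrow> f x = 0" "x \<notin> K"
  shows "frechet_derivative f (at x) = (\<lambda>v. 0)"
proof -
  have "(f has_derivative (\<lambda>v. 0)) (at x)"
    by (rule has_derivative_transform_within_open[OF has_derivative_const[of 0], where s = "- K"])
      (use assms in auto)
  then show ?thesis
    using frechet_derivative_at by metis
qed

lemma field_deriv_eq_0_off_support:
  assumes "closed K" "\<And>x. x \<notin> K \<Longrightarrow> f x = 0" "x \<notin> K"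
  shows "field_deriv X f x = 0"
  using frechet_derivative_eq_0_off_support[OF assms] by (simp add: field_deriv_def)

text \<open>The weights \<open>1/\<rho>\<^sup>2\<close> are singular, but they only multiply functions that vanish near the
  singularity. Since \<open>a / 0 = 0\<close>, the quotient is then \<open>0\<close> near every zero of \<open>s\<close>, so it is of class
  \<open>C\<^sup>1\<close> on the whole space and the quotient rule holds at every point, zeros of \<open>s\<close> included.\<close>
lemma divide_supported:
  fixes p s :: "'a::euclidean_space \<Rightarrow> real"
  assumes p: "C_k (Suc 0) p" and s: "C_k (Suc 0) s"
    and K: "closed K" "\<And>x. x \<notin> K \<Longrightarrow> p x = 0" "\<And>x. x \<in> K \<Longrightarrow> s x \<noteq> 0"
  shows C_k_divide_supported: "C_k (Suc 0) (\<lambda>x. p x / s x)"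
    and field_deriv_divide_supported: "field_deriv X (\<lambda>x. p x / s x) x =
      field_deriv X p x / s x - p x * field_deriv X s x / (s x)\<^sup>2"
proof -
  define F where "F x v = frechet_derivative p (at x) v / s x
    - p x * frechet_derivative s (at x) v / (s x)\<^sup>2" for x v
  have F: "((\<lambda>x. p x / s x) has_derivative F x) (at x)" for x
  proof (cases "s x = 0")
    case True
    then have x: "x \<notin> K" using K(3) by blast
    have "((\<lambda>x. p x / s x) has_derivative (\<lambda>v. 0)) (at x)"
      by (rule has_derivative_transform_within_open[OF has_derivative_const[of 0], where s = "- K"])
        (use x K in auto)
    moreover have "F x = (\<lambda>v. 0)"
      using True by (simp add: F_def fun_eq_iff)
    ultimately show ?thesis by simp
  next
    case False
    show ?thesis
      by (rule has_derivative_eq_rhs[OF has_derivative_divide[OF C_k_frechet_derivative[OF p]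
              C_k_frechet_derivative[OF s] False]])
        (use False in \<open>simp add: F_def fun_eq_iff field_simps power2_eq_square\<close>)
  qed
  have "continuous_on UNIV (\<lambda>x. F x b)" if "b \<in> Basis" for b
  proof -
    have c: "continuous_on UNIV p" "continuous_on UNIV s"
      "continuous_on UNIV (\<lambda>x. frechet_derivative p (at x) b)"
      "continuous_on UNIV (\<lambda>x. frechet_derivative s (at x) b)"
      using p s that by (auto simp: differentiable_imp_continuous_on)
    have o: "open {x. s x \<noteq> 0}"
      using c(2) by (intro open_Collect_neq) (auto simp: continuous_on_eq_continuous_at)
    have "continuous_on {x. s x \<noteq> 0} (\<lambda>x. F x b)"
      unfolding F_def
      by (intro continuous_intros continuous_on_subset[OF c(1)] continuous_on_subset[OF c(2)]
          continuous_on_subset[OF c(3)] continuous_on_subset[OF c(4)]) auto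
    moreover have "continuous_on (- K) (\<lambda>x. F x b)"
    proof -
      have "F x b = 0" if "x \<notin> K" for x
        using frechet_derivative_eq_0_off_support[OF K(1,2) that] K(2)[OF that] by (simp add: F_def)
      then show ?thesis
        by (intro continuous_on_eq[OF continuous_on_const[of _ 0]]) simp
    qed
    \<comment> \<open>The two open sets on which continuity is known cover the space.\<close>
    ultimately have "continuous_on ({x. s x \<noteq> 0} \<union> - K) (\<lambda>x. F x b)"
      using o K(1) by (intro continuous_on_open_Un) auto
    moreover have "{x. s x \<noteq> 0} \<union> - K = UNIV"
      using K(3) by auto
    ultimately show ?thesis by simp
  qed
  then show "C_k (Suc 0) (\<lambda>x. p x / s x)"
    by (intro C_k_SucI[OF F]) simp
  show "field_deriv X (\<lambda>x. p x / s x) x =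
      field_deriv X p x / s x - p x * field_deriv X s x / (s x)\<^sup>2"
    using field_deriv_eqI[OF F] by (simp add: F_def field_deriv_def)
qed

section \<open>The divergence theorem for compactly supported functions\<close>

lemma integrable_compact_support:
  fixes g :: "'a::euclidean_space \<Rightarrow> 'b::euclidean_space"
  assumes "compact K" "continuous_on K g" "\<And>x. x \<notin> K \<Longrightarrow> g x = 0"
  shows "integrable lborel g"
proof -
  have "(\<lambda>x. indicator K x *\<^sub>R g x) = g"
    using assms(3) by (auto simp: fun_eq_iff indicator_def)
  then show ?thesis
    using borel_integrable_compact[OF assms(1,2)] by simp
qed

lemma integral_translate:
  fixes g :: "'a::euclidean_space \<Rightarrow> real"
  assumes "continuous_on UNIV g"
  shows "(LINT x|lborel. g (x + c)) = (LINT x|lborel. g x)"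
proof -
  have m: "g \<in> borel_measurable borel"
    using assms by (simp add: borel_measurable_continuous_onI)
  have "(LINT x|lborel. g x) = (LINT x|distr lborel borel ((+) c). g x)"
    by (simp add: lborel_distr_plus)
  also have "\<dots> = (LINT x|lborel. g (c + x))"
    using m by (intro integral_distr) auto
  finally show ?thesis by (simp add: add.commute)
qed

text \<open>By translation invariance every difference quotient of \<open>g\<close> integrates to \<open>0\<close>. By the mean value
  theorem the quotients with step at most \<open>1\<close> are bounded by \<open>sup \<bar>\<partial>\<^sub>b g\<bar>\<close> on one fixed ball and
  vanish outside it, so dominated convergence passes to the limit.\<close>
lemma integral_partial_derivative_eq_0:
  fixes g :: "'a::euclidean_space \<Rightarrow> real"
  assumes g: "C_k (Suc 0) g" and K: "compact K" "\<And>x. x \<notin> K \<Longrightarrow> g x = 0"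
    and b: "b \<in> Basis"
  shows "(LINT x|lborel. frechet_derivative g (at x) b) = 0"
proof -
  define d where "d x = frechet_derivative g (at x) b" for x
  have cg: "continuous_on UNIV g" and cd: "continuous_on UNIV d"
    using g b by (auto simp: differentiable_imp_continuous_on d_def[abs_def])
  have clK: "closed K" using K(1) by (rule compact_imp_closed)
  have d0: "d x = 0" if "x \<notin> K" for x
    using frechet_derivative_eq_0_off_support[OF clK K(2) that] by (simp add: d_def)
  obtain B where B: "\<And>x. x \<in> K \<Longrightarrow> norm (d x) \<le> B" "B > 0"
    using compact_imp_bounded[OF compact_continuous_image[OF continuous_on_subset[OF cd] K(1)]]
    by (auto simp: bounded_pos)
  have B': "\<bar>d x\<bar> \<le> B" for x
    using B d0[of x] by (cases "x \<in> K") auto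
  obtain R where R: "\<And>x. x \<in> K \<Longrightarrow> norm x \<le> R"
    using compact_imp_bounded[OF K(1)] by (auto simp: bounded_pos)
  have der: "((\<lambda>t. g (x + t *\<^sub>R b)) has_real_derivative d (x + t *\<^sub>R b)) (at t)" for x t
  proof -
    have "((\<lambda>t. g (x + t *\<^sub>R b)) has_derivative
        (\<lambda>h. frechet_derivative g (at (x + t *\<^sub>R b)) (h *\<^sub>R b))) (at t)"
      by (rule has_derivative_compose[OF _ C_k_frechet_derivative[OF g]])
        (auto intro!: derivative_eq_intros)
    moreover have "linear (frechet_derivative g (at (x + t *\<^sub>R b)))"
      using C_k_frechet_derivative[OF g] has_derivative_linear by blast
    ultimately show ?thesis
      unfolding has_field_derivative_def
      by (elim has_derivative_eq_rhs) (simp add: fun_eq_iff d_def linear_scale)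
  qed
  define t where "t n = 1 / real (Suc n)" for n
  have t: "0 < t n" "t n \<le> 1" for n by (auto simp: t_def)
  have t0: "t \<longlonglongrightarrow> 0"
    unfolding t_def[abs_def] using LIMSEQ_inverse_real_of_nat by (simp add: inverse_eq_divide)
  define s where "s n x = (g (x + t n *\<^sub>R b) - g x) / t n" for n x
  have lim: "(\<lambda>n. s n x) \<longlonglongrightarrow> d x" for x
  proof -
    have "((\<lambda>h. (g (x + h *\<^sub>R b) - g x) / h) \<longlongrightarrow> d x) (at 0)"
      using der[of x 0] by (simp add: DERIV_def)
    then show ?thesis
      unfolding s_def
      by (rule filterlim_compose) (use t t0 in \<open>auto simp: filterlim_at less_imp_neq[symmetric] eventually_sequentially\<close>)
  qed
  have bound: "norm (s n x) \<le> indicator (cball 0 (R + 1)) x *\<^sub>R B" for n x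
  proof -
    obtain z where z: "g (x + t n *\<^sub>R b) - g (x + 0 *\<^sub>R b) = (t n - 0) * d (x + z *\<^sub>R b)"
      using MVT2[OF t(1)[of n], of "\<lambda>t. g (x + t *\<^sub>R b)" "\<lambda>t. d (x + t *\<^sub>R b)"] der by blast
    have s: "\<bar>s n x\<bar> \<le> B"
      using z t(1)[of n] B' by (simp add: s_def)
    show ?thesis
    proof (cases "norm x \<le> R + 1")
      case True
      then show ?thesis using s by simp
    next
      case False
      have "norm x \<le> norm (x + t n *\<^sub>R b) + norm (t n *\<^sub>R b)"
        by (metis add_diff_cancel_right' norm_triangle_ineq4)
      then have "x \<notin> K" "x + t n *\<^sub>R b \<notin> K"
        using False R[of x] R[of "x + t n *\<^sub>R b"] b t[of n] by auto
      then show ?thesis using K(2) False by (simp add: s_def)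
    qed
  qed
  have int_g: "integrable lborel g"
    by (rule integrable_compact_support[OF K(1) continuous_on_subset[OF cg subset_UNIV] K(2)])
  have "(LINT x|lborel. s n x) = 0" for n
  proof -
    define K' where "K' = (+) (- (t n *\<^sub>R b)) ` K"
    have K': "compact K'"
      unfolding K'_def by (rule compact_translation[OF K(1)])
    have c: "continuous_on UNIV (\<lambda>x. g (x + t n *\<^sub>R b))"
      by (intro continuous_intros continuous_on_compose2[OF cg]) auto
    have 0: "g (x + t n *\<^sub>R b) = 0" if "x \<notin> K'" for x
    proof (rule K(2), rule notI)
      assume "x + t n *\<^sub>R b \<in> K"
      then have "- (t n *\<^sub>R b) + (x + t n *\<^sub>R b) \<in> K'"
        unfolding K'_def by (rule imageI)
      then show False using that by simp
    qed
    have "integrable lborel (\<lambda>x. g (x + t n *\<^sub>R b))"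
      by (rule integrable_compact_support[OF K' continuous_on_subset[OF c subset_UNIV] 0])
    then show ?thesis
      using int_g integral_translate[OF cg] by (simp add: s_def)
  qed
  moreover have "(\<lambda>n. LINT x|lborel. s n x) \<longlonglongrightarrow> (LINT x|lborel. d x)"
  proof (rule integral_dominated_convergence)
    show "integrable lborel (\<lambda>x. indicator (cball 0 (R + 1)) x *\<^sub>R B :: real)"
      by (rule borel_integrable_compact) auto
    show "d \<in> borel_measurable lborel"
      using cd by (simp add: borel_measurable_continuous_onI)
    show "s n \<in> borel_measurable lborel" for n
      unfolding s_def[abs_def]
      by (simp, intro borel_measurable_continuous_onI continuous_intros continuous_on_compose2[OF cg])
        (use t[of n] in auto)
    show "AE x in lborel. (\<lambda>n. s n x) \<longlonglongrightarrow> d x" using lim by simp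
    show "AE x in lborel. norm (s n x) \<le> indicator (cball 0 (R + 1)) x *\<^sub>R B" for n
      using bound by simp
  qed
  ultimately have "(\<lambda>n. 0) \<longlonglongrightarrow> (LINT x|lborel. d x)"
    by simp
  then show ?thesis
    by (simp add: LIMSEQ_const_iff d_def)
qed

text \<open>For a divergence free field \<open>X g = \<Sum>\<^sub>b \<partial>\<^sub>b (X\<^sub>b g)\<close>, and each summand integrates to zero.\<close>
theorem integral_field_deriv_eq_0:
  fixes g :: "'a::euclidean_space \<Rightarrow> real" and X :: "'a \<Rightarrow> 'a"
  assumes X: "C_k (Suc 0) X"
    and div: "\<And>x. (\<Sum>b\<in>Basis. frechet_derivative X (at x) b \<bullet> b) = 0"
    and g: "C_k (Suc 0) g" and K: "compact K" "\<And>x. x \<notin> K \<Longrightarrow> g x = 0"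
  shows "(LINT x|lborel. field_deriv X g x) = 0"
proof -
  define h where "h b x = (X x \<bullet> b) * g x" for b x
  have ch: "C_k (Suc 0) (h b)" for b
    unfolding h_def[abs_def] by (intro C_k_mult C_k_inner X g C_k_const)
  have h0: "h b x = 0" if "x \<notin> K" for b x
    using K(2)[OF that] by (simp add: h_def)
  have dh: "frechet_derivative (h b) (at x) b =
      (frechet_derivative X (at x) b \<bullet> b) * g x + (X x \<bullet> b) *\<^sub>R frechet_derivative g (at x) b" for b x
  proof -
    have "(h b has_derivative (\<lambda>v. (X x \<bullet> b) * frechet_derivative g (at x) v
        + (frechet_derivative X (at x) v \<bullet> b) * g x)) (at x)"
      unfolding h_def[abs_def]
      by (rule has_derivative_mult[OF has_derivative_inner_left[OF C_k_frechet_derivative[OF X]]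
            C_k_frechet_derivative[OF g]])
    from frechet_derivative_at[OF this, symmetric] show ?thesis by simp
  qed
  have "field_deriv X g x = (\<Sum>b\<in>Basis. frechet_derivative (h b) (at x) b)" for x
    unfolding dh sum.distrib field_deriv_Basis[OF g]
    by (simp add: sum_distrib_right[symmetric] div)
  moreover have "integrable lborel (\<lambda>x. frechet_derivative (h b) (at x) b)" if "b \<in> Basis" for b
  proof (rule integrable_compact_support[OF K(1)])
    show "continuous_on K (\<lambda>x. frechet_derivative (h b) (at x) b)"
      using ch[of b] that by (auto intro: continuous_on_subset)
    show "frechet_derivative (h b) (at x) b = 0" if "x \<notin> K" for x
      using frechet_derivative_eq_0_off_support[OF compact_imp_closed[OF K(1)] h0 that] by simp
  qed
  ultimately have "(LINT x|lborel. field_deriv X g x) =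
      (\<Sum>b\<in>Basis. LINT x|lborel. frechet_derivative (h b) (at x) b)"
    by (simp add: Bochner_Integration.integral_sum)
  also have "\<dots> = 0"
    by (intro sum.neutral ballI integral_partial_derivative_eq_0[OF ch K(1) h0])
  finally show ?thesis .
qed

section \<open>Left invariant fields of the first stratum\<close>

lemma dilation_linear: "bounded_linear (dilation w l)"
proof -
  have "linear (dilation w l)"
    by (rule linearI) (simp_all add: dilation_def vec_eq_iff algebra_simps)
  then show ?thesis by (simp add: linear_conv_bounded_linear)
qed

lemma dilation_axis: "dilation w l (axis i c) = l ^ w i *\<^sub>R axis i c"
  by (simp add: dilation_def vec_eq_iff axis_def)

lemma dilation_tendsto_0:
  assumes "\<And>i. 0 < w i"
  shows "((\<lambda>l. dilation w l x) \<longlongrightarrow> 0) (at_right 0)"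
proof -
  have "((\<lambda>l. dilation w l x $ i) \<longlongrightarrow> 0 ^ w i * x $ i) (at_right 0)" for i
    unfolding dilation_def by (simp, intro tendsto_intros)
  then show ?thesis
    by (intro vec_tendstoI) (simp add: assms power_0_left less_imp_neq[OF assms, symmetric])
qed

context
  fixes mul :: "real^'n \<Rightarrow> real^'n \<Rightarrow> real^'n" and iv and w :: "'n::finite \<Rightarrow> nat" and r X k
  assumes strat: "stratified_group mul iv w r"
    and frame: "horizontal_frame mul w X"
    and k: "k \<in> first_stratum w"
begin

interpretation stratified_group mul iv w r by (rule strat)

lemma weight_pos: "0 < w i"
proof -
  have "w i \<in> {1..r}" unfolding strata[symmetric] by simp
  then show ?thesis by simp
qed

lemma horizontal_C_k: "C_k n (X k)"
  using frame k by (simp add: horizontal_frame_def left_invariant_def smooth_def)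

text \<open>Left invariance gives \<open>X\<^sub>k x = d(mul x)\<^sub>0 e\<^sub>k\<close>. The claim is the derivative at \<open>y = 0\<close>, in the
  direction \<open>e\<^sub>k\<close>, of the identity \<open>D\<^sub>l (mul x y) = mul (D\<^sub>l x) (D\<^sub>l y)\<close>, where \<open>D\<^sub>l e\<^sub>k = l e\<^sub>k\<close>.\<close>
lemma horizontal_homogeneous:
  assumes "l > 0"
  shows "l *\<^sub>R X k (dilation w l x) = dilation w l (X k x)"
proof -
  have wk: "w k = 1" using k by (simp add: first_stratum_def)
  have Xk: "frechet_derivative (mul y) (at 0) (axis k 1) = X k y" for y
  proof -
    have "left_invariant mul (X k)" "X k 0 = axis k 1"
      using frame k by (auto simp: horizontal_frame_def)
    then have "frechet_derivative (mul y) (at 0) (axis k 1) = X k (mul y 0)"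
      by (metis left_invariant_def)
    then show ?thesis by simp
  qed
  have mul': "(mul y has_derivative frechet_derivative (mul y) (at 0)) (at 0)" for y
  proof -
    have "(\<lambda>(x, y). mul x y) differentiable at (y, 0)"
      using smooth_mul[unfolded smooth_def, rule_format, of "Suc 0"]
      by (simp add: differentiable_on_def)
    then obtain M where M: "((\<lambda>(x, y). mul x y) has_derivative M) (at (y, 0))"
      by (auto simp: differentiable_def)
    have "((\<lambda>z. (y, z)) has_derivative (\<lambda>h. (0, h))) (at 0)"
      by (auto intro!: derivative_eq_intros)
    from has_derivative_compose[OF this M] have "mul y differentiable at 0"
      by (auto simp: differentiable_def)
    then show ?thesis by (simp add: frechet_derivative_works)
  qed
  have D0: "dilation w l 0 = 0" by (simp add: dilation_def vec_eq_iff)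
  have "((\<lambda>y. dilation w l (mul x y)) has_derivative
      (\<lambda>v. dilation w l (frechet_derivative (mul x) (at 0) v))) (at 0)"
    by (rule bounded_linear.has_derivative[OF dilation_linear mul'])
  moreover have "((\<lambda>y. mul (dilation w l x) (dilation w l y)) has_derivative
      (\<lambda>v. frechet_derivative (mul (dilation w l x)) (at 0) (dilation w l v))) (at 0)"
    by (rule has_derivative_compose[OF bounded_linear_imp_has_derivative[OF dilation_linear]])
      (simp add: D0 mul')
  moreover have "dilation w l (mul x y) = mul (dilation w l x) (dilation w l y)" for y
    using dilation_automorphism[OF assms] by (simp add: lie_automorphism_def)
  ultimately have "(\<lambda>v. dilation w l (frechet_derivative (mul x) (at 0) v)) =
      (\<lambda>v. frechet_derivative (mul (dilation w l x)) (at 0) (dilation w l v))"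
    by (intro has_derivative_unique) simp_all
  from fun_cong[OF this, of "axis k 1"]
  have "dilation w l (X k x) = frechet_derivative (mul (dilation w l x)) (at 0) (l *\<^sub>R axis k 1)"
    by (simp add: Xk dilation_axis wk)
  also have "\<dots> = l *\<^sub>R X k (dilation w l x)"
    using linear_scale[OF has_derivative_linear[OF mul'[of "dilation w l x"]]] by (simp add: Xk)
  finally show ?thesis by simp
qed

text \<open>A coefficient of weight \<open>1\<close> is invariant under dilations, and \<open>D\<^sub>l x\<close> tends to the origin as
  \<open>l \<rightarrow> 0\<close>; by continuity the coefficient has its value at the origin everywhere.\<close>
lemma horizontal_coordinate:
  assumes "j \<in> first_stratum w"
  shows "X k x $ j = (if j = k then 1 else 0)"
proof -
  have "X k (dilation w l x) $ j = X k x $ j" if "l > 0" for l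
    using arg_cong[OF horizontal_homogeneous[OF that], of "\<lambda>v. v $ j" x] that assms
    by (simp add: dilation_def first_stratum_def)
  then have "\<forall>\<^sub>F l in at_right 0. X k (dilation w l x) $ j = X k x $ j"
    by (auto simp: eventually_at_filter)
  moreover have "((\<lambda>l. X k (dilation w l x) $ j) \<longlongrightarrow> X k 0 $ j) (at_right 0)"
    using C_k_imp_continuous_on[OF horizontal_C_k[of 0]]
    by (intro tendsto_vec_nth isCont_tendsto_compose[OF _ dilation_tendsto_0[OF weight_pos]])
      (simp add: continuous_on_eq_continuous_at)
  ultimately have "((\<lambda>l. X k x $ j) \<longlongrightarrow> X k 0 $ j) (at_right (0::real))"
    by (rule Lim_transform_eventually[rotated])
  then have "X k x $ j = X k 0 $ j"
    by (simp add: tendsto_const_iff)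
  then show ?thesis
    using frame k by (simp add: horizontal_frame_def axis_def)
qed

text \<open>Every diagonal entry \<open>a\<close> of the Jacobian satisfies \<open>a x = l a (D\<^sub>l x)\<close>, because differentiating
  along \<open>x\<^sub>i\<close> lowers the degree \<open>w i - 1\<close> by \<open>w i\<close>. The right-hand side tends to \<open>0 \<cdot> a 0\<close> as \<open>l \<rightarrow> 0\<close>.\<close>
lemma horizontal_divergence_free:
  "(\<Sum>b\<in>Basis. frechet_derivative (X k) (at x) b \<bullet> b) = 0"
proof -
  define D where "D y = frechet_derivative (X k) (at y)" for y
  have D: "(X k has_derivative D y) (at y)" for y
    unfolding D_def by (rule C_k_frechet_derivative[OF horizontal_C_k])
  have "D x (axis i 1) $ i = 0" for i
  proof -
    define a where "a y = D y (axis i 1) $ i" for y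
    have a: "l * a (dilation w l x) = a x" if l: "l > 0" for l
    proof -
      have "((\<lambda>y. l *\<^sub>R X k (dilation w l y)) has_derivative
          (\<lambda>v. l *\<^sub>R D (dilation w l x) (dilation w l v))) (at x)"
        by (intro has_derivative_scaleR_right has_derivative_compose[OF
              bounded_linear_imp_has_derivative[OF dilation_linear] D])
      moreover have "((\<lambda>y. dilation w l (X k y)) has_derivative (\<lambda>v. dilation w l (D x v))) (at x)"
        by (rule bounded_linear.has_derivative[OF dilation_linear D])
      ultimately have "(\<lambda>v. l *\<^sub>R D (dilation w l x) (dilation w l v)) = (\<lambda>v. dilation w l (D x v))"
        by (intro has_derivative_unique) (simp_all add: horizontal_homogeneous[OF l])
      from fun_cong[OF this, of "axis i 1"]
      have "l *\<^sub>R D (dilation w l x) (l ^ w i *\<^sub>R axis i 1) = dilation w l (D x (axis i 1))"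
        by (simp add: dilation_axis)
      then have "l ^ w i * (l * a (dilation w l x)) = l ^ w i * a x"
        unfolding a_def linear_scale[OF has_derivative_linear[OF D]]
        by (simp add: vec_eq_iff dilation_def mult_ac)
      then show ?thesis using l by simp
    qed
    have "continuous_on UNIV (\<lambda>y. D y (axis i 1))"
      using horizontal_C_k[of "Suc 0"] by (simp add: D_def Basis_vec_def)
    then have "((\<lambda>l. l * a (dilation w l x)) \<longlongrightarrow> 0 * a 0) (at_right 0)"
      unfolding a_def
      by (intro tendsto_intros tendsto_vec_nth
          isCont_tendsto_compose[OF _ dilation_tendsto_0[OF weight_pos]])
        (simp add: continuous_on_eq_continuous_at)
    moreover have "\<forall>\<^sub>F l in at_right 0. l * a (dilation w l x) = a x"
      using a by (auto simp: eventually_at_filter)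
    ultimately have "((\<lambda>l. a x) \<longlongrightarrow> 0 * a 0) (at_right (0::real))"
      by (rule Lim_transform_eventually)
    then show ?thesis
      by (simp add: tendsto_const_iff a_def)
  qed
  then show ?thesis
    by (auto simp: D_def[symmetric] Basis_vec_def inner_axis intro!: sum.neutral)
qed

end

section \<open>Integration by parts against powers of the horizontal distance\<close>

lemma norm_proj1_squared: "(norm (proj1 w x))\<^sup>2 = (\<Sum>k\<in>first_stratum w. (x $ k)\<^sup>2)"
  unfolding power2_norm_eq_inner inner_vec_def
  by (rule sum.mono_neutral_cong_right) (auto simp: proj1_def power2_eq_square)

lemma C_k_norm_proj1_squared: "C_k n (\<lambda>x. (norm (proj1 w x))\<^sup>2)"
  unfolding norm_proj1_squared power2_eq_square[of "_ $ _"]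
  by (intro C_k_sum C_k_mult C_k_bounded_linear bounded_linear_vec_nth)

lemma norm_hgrad_squared:
  "(norm (hgrad w X f x))\<^sup>2 =
    (\<Sum>k\<in>first_stratum w. field_deriv (X k) f x \<bullet> field_deriv (X k) f x)"
  unfolding power2_norm_eq_inner inner_vec_def
  by (rule sum.mono_neutral_cong_right) (auto simp: hgrad_def)

lemma inner_radial_hderiv:
  "y \<bullet> radial_hderiv w X f x = (\<Sum>k\<in>first_stratum w. x $ k * (y \<bullet> field_deriv (X k) f x))"
  by (simp add: radial_hderiv_def inner_sum_right scaleR_conv_of_real[symmetric])

lemma L2_norm_squared: "(L2_norm g)\<^sup>2 = (LINT x|lborel. (norm (g x))\<^sup>2)"
  by (simp add: L2_norm_def)

context
  fixes mul :: "real^'n \<Rightarrow> real^'n \<Rightarrow> real^'n" and iv and w :: "'n::finite \<Rightarrow> nat" and r X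
    and f :: "real^'n \<Rightarrow> complex"
  assumes strat: "stratified_group mul iv w r"
    and frame: "horizontal_frame mul w X"
    and test: "test_function {x. proj1 w x \<noteq> 0} f"
begin

private abbreviation (input) "S \<equiv> first_stratum w"
private abbreviation (input) "\<sigma> x \<equiv> (norm (proj1 w x))\<^sup>2"
private abbreviation (input) "P k \<equiv> field_deriv (X k) f"
private abbreviation (input) "K \<equiv> closure {x. f x \<noteq> 0}"

lemma compact_support: "compact K"
  using test by (simp add: test_function_def)

lemma support:
  shows eq_0_off_support: "x \<notin> K \<Longrightarrow> f x = 0"
    and hderiv_eq_0_off_support: "x \<notin> K \<Longrightarrow> P k x = 0"
    and dist_nonzero_on_support: "x \<in> K \<Longrightarrow> \<sigma> x \<noteq> 0"
proof -
  show *: "x \<notin> K \<Longrightarrow> f x = 0" for x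
    using closure_subset[of "{x. f x \<noteq> 0}"] by auto
  show "x \<notin> K \<Longrightarrow> P k x = 0"
    by (rule field_deriv_eq_0_off_support[OF closed_closure *])
  show "x \<in> K \<Longrightarrow> \<sigma> x \<noteq> 0"
    using test by (auto simp: test_function_def)
qed

lemma C_k_test: "C_k n f"
  using test by (simp add: test_function_def smooth_def)

lemma C_k_hderiv: "k \<in> S \<Longrightarrow> C_k n (P k)"
  by (intro C_k_field_deriv horizontal_C_k[OF strat frame] C_k_test)

lemma field_deriv_coordinate:
  "k \<in> S \<Longrightarrow> j \<in> S \<Longrightarrow> field_deriv (X k) (\<lambda>x. x $ j) x = (if j = k then 1 else 0)"
  by (subst field_deriv_eqI[OF bounded_linear_imp_has_derivative[OF bounded_linear_vec_nth]])
    (rule horizontal_coordinate[OF strat frame])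

lemma field_deriv_norm_proj1_squared:
  assumes "k \<in> S"
  shows "field_deriv (X k) \<sigma> x = 2 * x $ k"
proof -
  have "(\<sigma> has_derivative (\<lambda>v. \<Sum>j\<in>S. 2 * x $ j * v $ j)) (at x)"
    unfolding norm_proj1_squared
    by (auto intro!: derivative_eq_intros bounded_linear.has_derivative[OF bounded_linear_vec_nth]
        sum.cong)
  from field_deriv_eqI[OF this] show ?thesis
    using assms by (simp add: horizontal_coordinate[OF strat frame] if_distrib cong: if_cong)
qed

text \<open>Integration by parts for one field, with \<open>X\<^sub>k \<rho>\<^sup>2 = 2 x\<^sub>k\<close> inserted into the quotient rule for
  \<open>p/\<rho>\<^sup>2\<close>.\<close>
lemma integral_hderiv_divide_eq_0:
  assumes k: "k \<in> S" and p: "C_k (Suc 0) p" "\<And>x. x \<notin> K \<Longrightarrow> p x = 0"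
  shows "(LINT x|lborel. field_deriv (X k) p x / \<sigma> x - 2 * x $ k * p x / (\<sigma> x)\<^sup>2) = 0"
    and "integrable lborel (\<lambda>x. field_deriv (X k) p x / \<sigma> x - 2 * x $ k * p x / (\<sigma> x)\<^sup>2)"
proof -
  define q where "q x = p x / \<sigma> x" for x
  have q: "C_k (Suc 0) q"
    unfolding q_def[abs_def]
    by (rule C_k_divide_supported[OF p(1) C_k_norm_proj1_squared closed_closure p(2)
          dist_nonzero_on_support])
  have q0: "x \<notin> K \<Longrightarrow> q x = 0" for x
    by (simp add: q_def p(2))
  have eq: "field_deriv (X k) q x = field_deriv (X k) p x / \<sigma> x - 2 * x $ k * p x / (\<sigma> x)\<^sup>2" for x
    unfolding q_def[abs_def]
    by (subst field_deriv_divide_supported[OF p(1) C_k_norm_proj1_squared closed_closure p(2)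
          dist_nonzero_on_support]) (simp_all add: field_deriv_norm_proj1_squared[OF k] mult_ac)
  show "(LINT x|lborel. field_deriv (X k) p x / \<sigma> x - 2 * x $ k * p x / (\<sigma> x)\<^sup>2) = 0"
    unfolding eq[symmetric]
    by (rule integral_field_deriv_eq_0[OF horizontal_C_k[OF strat frame k]
          horizontal_divergence_free[OF strat frame k] q compact_support q0])
  have "integrable lborel (field_deriv (X k) q)"
    by (rule integrable_compact_support[OF compact_support
          continuous_on_subset[OF C_k_imp_continuous_on subset_UNIV]
          field_deriv_eq_0_off_support[OF closed_closure q0]])
      (rule C_k_field_deriv[OF horizontal_C_k[OF strat frame k] q])
  then show "integrable lborel (\<lambda>x. field_deriv (X k) p x / \<sigma> x - 2 * x $ k * p x / (\<sigma> x)\<^sup>2)"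
    by (simp add: eq[abs_def])
qed

text \<open>The horizontal divergence of the field \<open>|f|\<^sup>2 x'/\<rho>\<^sup>4\<close>, whose second factor has divergence
  \<open>(N - 4)/\<rho>\<^sup>4\<close>. The real inner product on \<open>\<complex>\<close> is \<open>Re (a \<cdot> cnj b)\<close>, so that the second
  summand comes from \<open>R |f|\<^sup>2 = 2 Re (cnj f \<cdot> R f)\<close>.\<close>
lemma integral_inner_radial:
  "(LINT x|lborel. (real (card S) - 4) * ((f x \<bullet> f x) / (\<sigma> x)\<^sup>2)
      + 2 * ((f x \<bullet> radial_hderiv w X f x) / (\<sigma> x)\<^sup>2)) = 0"
proof -
  define p where "p k x = x $ k * (f x \<bullet> f x) / \<sigma> x" for k x
  define G where "G k x = field_deriv (X k) (p k) x / \<sigma> x - 2 * x $ k * p k x / (\<sigma> x)\<^sup>2" for k x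
  have s: "C_k (Suc 0) (\<lambda>x. x $ k * (f x \<bullet> f x))" for k
    by (intro C_k_mult C_k_inner C_k_test C_k_bounded_linear bounded_linear_vec_nth)
  have s0: "x \<notin> K \<Longrightarrow> x $ k * (f x \<bullet> f x) = 0" for x k
    by (drule eq_0_off_support) simp
  have p: "C_k (Suc 0) (p k)" for k
    unfolding p_def[abs_def]
    by (rule C_k_divide_supported[OF s C_k_norm_proj1_squared closed_closure s0
          dist_nonzero_on_support])
  have p0: "x \<notin> K \<Longrightarrow> p k x = 0" for x k
    by (drule eq_0_off_support) (simp add: p_def)
  have G: "G k x = (f x \<bullet> f x) / (\<sigma> x)\<^sup>2 + 2 * (x $ k * (f x \<bullet> P k x)) / (\<sigma> x)\<^sup>2
      - 4 * (f x \<bullet> f x) / (\<sigma> x) ^ 3 * (x $ k)\<^sup>2" if k: "k \<in> S" for k x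
  proof -
    have "field_deriv (X k) (\<lambda>x. x $ k * (f x \<bullet> f x)) x = x $ k * (2 * (f x \<bullet> P k x)) + f x \<bullet> f x"
      by (simp add: bounded_bilinear.field_deriv[OF bounded_bilinear_mult
            C_k_bounded_linear[OF bounded_linear_vec_nth] C_k_inner[OF C_k_test C_k_test]]
          bounded_bilinear.field_deriv[OF bounded_bilinear_inner C_k_test C_k_test]
          field_deriv_coordinate[OF k k] inner_commute)
    then have "field_deriv (X k) (p k) x = (x $ k * (2 * (f x \<bullet> P k x)) + f x \<bullet> f x) / \<sigma> x
        - x $ k * (f x \<bullet> f x) * (2 * x $ k) / (\<sigma> x)\<^sup>2"
      unfolding p_def[abs_def]
      by (subst field_deriv_divide_supported[OF s C_k_norm_proj1_squared closed_closure s0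
            dist_nonzero_on_support]) (simp_all add: field_deriv_norm_proj1_squared[OF k])
    moreover have "((y * (2 * e) + c) / s - y * c * (2 * y) / s\<^sup>2) / s - 2 * y * (y * c / s) / s\<^sup>2 =
        c / s\<^sup>2 + 2 * (y * e) / s\<^sup>2 - 4 * c / s ^ 3 * y\<^sup>2" for y e c s :: real
      by (cases "s = 0") (simp_all add: field_simps power2_eq_square power3_eq_cube)
    ultimately show ?thesis
      by (simp only: G_def p_def)
  qed
  have "(\<Sum>k\<in>S. G k x) = (real (card S) - 4) * ((f x \<bullet> f x) / (\<sigma> x)\<^sup>2)
      + 2 * ((f x \<bullet> radial_hderiv w X f x) / (\<sigma> x)\<^sup>2)" for x
  proof -
    have "(\<Sum>k\<in>S. G k x) = real (card S) * ((f x \<bullet> f x) / (\<sigma> x)\<^sup>2)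
        + 2 * (\<Sum>k\<in>S. x $ k * (f x \<bullet> P k x)) / (\<sigma> x)\<^sup>2
        - 4 * (f x \<bullet> f x) / (\<sigma> x) ^ 3 * (\<Sum>k\<in>S. (x $ k)\<^sup>2)"
      by (simp add: G sum.distrib sum_subtractf sum_distrib_left sum_divide_distrib)
    also have "\<dots> = real (card S) * ((f x \<bullet> f x) / (\<sigma> x)\<^sup>2)
        + 2 * (f x \<bullet> radial_hderiv w X f x) / (\<sigma> x)\<^sup>2 - 4 * (f x \<bullet> f x) / (\<sigma> x) ^ 3 * \<sigma> x"
      by (simp only: inner_radial_hderiv norm_proj1_squared)
    also have "4 * (f x \<bullet> f x) / (\<sigma> x) ^ 3 * \<sigma> x = 4 * ((f x \<bullet> f x) / (\<sigma> x)\<^sup>2)"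
      by (cases "\<sigma> x = 0") (simp_all add: field_simps power2_eq_square power3_eq_cube)
    finally show ?thesis
      by (simp add: algebra_simps diff_divide_distrib)
  qed
  moreover have "(LINT x|lborel. (\<Sum>k\<in>S. G k x)) = (\<Sum>k\<in>S. LINT x|lborel. G k x)"
    unfolding G_def
    by (intro Bochner_Integration.integral_sum integral_hderiv_divide_eq_0(2) p p0)
  moreover have "(\<Sum>k\<in>S. LINT x|lborel. G k x) = 0"
    unfolding G_def by (intro sum.neutral ballI integral_hderiv_divide_eq_0(1) p p0)
  ultimately show ?thesis by simp
qed

text \<open>The horizontal divergence of the field with components \<open>Re (cnj f \<cdot> X\<^sub>k f)/\<rho>\<^sup>2\<close>.\<close>
lemma integral_inner_sub_laplacian:
  "(LINT x|lborel. (f x \<bullet> sub_laplacian w X f x) / \<sigma> x + (norm (hgrad w X f x))\<^sup>2 / \<sigma> x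
      - 2 * ((f x \<bullet> radial_hderiv w X f x) / (\<sigma> x)\<^sup>2)) = 0"
proof -
  define p where "p k x = f x \<bullet> P k x" for k x
  define G where "G k x = field_deriv (X k) (p k) x / \<sigma> x - 2 * x $ k * p k x / (\<sigma> x)\<^sup>2" for k x
  have p: "C_k (Suc 0) (p k)" if "k \<in> S" for k
    unfolding p_def[abs_def] by (intro C_k_inner C_k_test C_k_hderiv that)
  have p0: "x \<notin> K \<Longrightarrow> p k x = 0" for x k
    by (drule eq_0_off_support) (simp add: p_def)
  have G: "G k x = (f x \<bullet> field_deriv (X k) (P k) x) / \<sigma> x + (P k x \<bullet> P k x) / \<sigma> x
      - 2 * (x $ k * (f x \<bullet> P k x)) / (\<sigma> x)\<^sup>2" if k: "k \<in> S" for k x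
    by (simp add: G_def p_def[abs_def] add_divide_distrib
        bounded_bilinear.field_deriv[OF bounded_bilinear_inner C_k_test C_k_hderiv[OF k]])
  have "(\<Sum>k\<in>S. G k x) = (f x \<bullet> sub_laplacian w X f x) / \<sigma> x + (norm (hgrad w X f x))\<^sup>2 / \<sigma> x
      - 2 * ((f x \<bullet> radial_hderiv w X f x) / (\<sigma> x)\<^sup>2)" for x
    unfolding inner_radial_hderiv norm_hgrad_squared sub_laplacian_def inner_sum_right
    by (simp add: G sum.distrib sum_subtractf sum_distrib_left sum_divide_distrib)
  moreover have "(LINT x|lborel. (\<Sum>k\<in>S. G k x)) = (\<Sum>k\<in>S. LINT x|lborel. G k x)"
    unfolding G_def
    by (intro Bochner_Integration.integral_sum integral_hderiv_divide_eq_0(2) p p0)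
  moreover have "(\<Sum>k\<in>S. LINT x|lborel. G k x) = 0"
    unfolding G_def by (intro sum.neutral ballI integral_hderiv_divide_eq_0(1) p p0)
  ultimately show ?thesis by simp
qed

lemma integrable_quadratic_terms:
  shows "integrable lborel (\<lambda>x. sub_laplacian w X f x \<bullet> sub_laplacian w X f x)"
    and "integrable lborel (\<lambda>x. (norm (hgrad w X f x))\<^sup>2 / \<sigma> x)"
    and "integrable lborel (\<lambda>x. (radial_hderiv w X f x \<bullet> radial_hderiv w X f x) / (\<sigma> x)\<^sup>2)"
    and "integrable lborel (\<lambda>x. (f x \<bullet> f x) / (\<sigma> x)\<^sup>2)"
    and "integrable lborel (\<lambda>x. (f x \<bullet> sub_laplacian w X f x) / \<sigma> x)"
    and "integrable lborel (\<lambda>x. (f x \<bullet> radial_hderiv w X f x) / (\<sigma> x)\<^sup>2)"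
proof -
  have cL: "continuous_on K (sub_laplacian w X f)"
    unfolding sub_laplacian_def[abs_def]
    by (intro continuous_on_sum
        continuous_on_subset[OF C_k_imp_continuous_on[where n = 0] subset_UNIV] C_k_field_deriv horizontal_C_k[OF strat frame] C_k_hderiv)
  have cP: "k \<in> S \<Longrightarrow> continuous_on K (P k)" for k
    by (intro continuous_on_subset[OF C_k_imp_continuous_on[where n = 0] subset_UNIV] C_k_hderiv)
  have cR: "continuous_on K (radial_hderiv w X f)"
    unfolding radial_hderiv_def[abs_def] by (intro continuous_intros cP)
  have cf: "continuous_on K f"
    by (rule continuous_on_subset[OF C_k_imp_continuous_on[OF C_k_test[of 0]] subset_UNIV])
  have c\<sigma>: "continuous_on K \<sigma>"
    by (rule continuous_on_subset[OF C_k_imp_continuous_on[OF C_k_norm_proj1_squared[of 0]] subset_UNIV])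
  have 0: "\<And>x. x \<in> K \<Longrightarrow> (\<sigma> x)\<^sup>2 \<noteq> 0"
    using dist_nonzero_on_support by simp
  have L0: "sub_laplacian w X f x = 0" and R0: "radial_hderiv w X f x = 0"
    and H0: "(\<Sum>k\<in>S. P k x \<bullet> P k x) = 0"
    if "x \<notin> K" for x
    using field_deriv_eq_0_off_support[OF closed_closure hderiv_eq_0_off_support that]
      hderiv_eq_0_off_support[OF that]
    by (simp_all add: sub_laplacian_def radial_hderiv_def)
  note integrableI = integrable_compact_support[OF compact_support]
  show "integrable lborel (\<lambda>x. sub_laplacian w X f x \<bullet> sub_laplacian w X f x)"
    by (rule integrableI) (auto intro!: continuous_intros cL simp: L0)
  show "integrable lborel (\<lambda>x. (norm (hgrad w X f x))\<^sup>2 / \<sigma> x)"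
    unfolding norm_hgrad_squared
  proof (rule integrableI)
    show "continuous_on K (\<lambda>x. (\<Sum>k\<in>S. P k x \<bullet> P k x) / \<sigma> x)"
      by (intro continuous_on_divide continuous_on_sum continuous_on_inner cP c\<sigma> ballI
          dist_nonzero_on_support)
  qed (simp add: H0)
  show "integrable lborel (\<lambda>x. (radial_hderiv w X f x \<bullet> radial_hderiv w X f x) / (\<sigma> x)\<^sup>2)"
    by (rule integrableI, intro continuous_on_divide continuous_on_inner continuous_on_power[of _ \<sigma>] cR c\<sigma> ballI 0)
      (simp_all add: R0)
  show "integrable lborel (\<lambda>x. (f x \<bullet> f x) / (\<sigma> x)\<^sup>2)"
    by (rule integrableI, intro continuous_on_divide continuous_on_inner continuous_on_power[of _ \<sigma>] cf c\<sigma> ballI 0)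
      (assumption, drule eq_0_off_support, simp)
  show "integrable lborel (\<lambda>x. (f x \<bullet> sub_laplacian w X f x) / \<sigma> x)"
    by (rule integrableI, intro continuous_on_divide continuous_on_inner cf cL c\<sigma> ballI
        dist_nonzero_on_support) (assumption, drule eq_0_off_support, simp)
  show "integrable lborel (\<lambda>x. (f x \<bullet> radial_hderiv w X f x) / (\<sigma> x)\<^sup>2)"
    by (rule integrableI, intro continuous_on_divide continuous_on_inner continuous_on_power[of _ \<sigma>] cf cR c\<sigma> ballI 0)
      (assumption, drule eq_0_off_support, simp)
qed

end

section \<open>The Hardy--Rellich type inequality\<close>

text \<open>The sum of the squared norms of \<open>u - a v - b g\<close> and \<open>u + a v - c g\<close> is nonnegative, and in it
  the products of \<open>u\<close> with \<open>v\<close> cancel.\<close>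
lemma factorization_inequality:
  fixes u v g :: "'a::real_inner" and a b c :: real
  shows "(b + c) * (g \<bullet> u) - a * (b - c) * (g \<bullet> v) - a\<^sup>2 * (v \<bullet> v) - (b\<^sup>2 + c\<^sup>2) / 2 * (g \<bullet> g) \<le> u \<bullet> u"
proof -
  have "0 \<le> (u - a *\<^sub>R v - b *\<^sub>R g) \<bullet> (u - a *\<^sub>R v - b *\<^sub>R g)
      + (u + a *\<^sub>R v - c *\<^sub>R g) \<bullet> (u + a *\<^sub>R v - c *\<^sub>R g)"
    by simp
  also have "\<dots> = 2 * (u \<bullet> u + a\<^sup>2 * (v \<bullet> v) + (b\<^sup>2 + c\<^sup>2) / 2 * (g \<bullet> g) - (b + c) * (g \<bullet> u)
      + a * (b - c) * (g \<bullet> v))"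
    by (simp add: inner_add_left inner_add_right inner_diff_left inner_diff_right inner_commute
        power2_eq_square algebra_simps)
  finally show ?thesis by simp
qed

theorem theorem4p1:
  fixes mul :: "real^'n \<Rightarrow> real^'n \<Rightarrow> real^'n" and iv :: "real^'n \<Rightarrow> real^'n"
    and w :: "'n::finite \<Rightarrow> nat" and r N :: nat
    and X :: "'n \<Rightarrow> real^'n \<Rightarrow> real^'n"
    and \<alpha> \<beta> :: real and f :: "real^'n \<Rightarrow> complex"
  assumes "stratified_group mul iv w r"
    and "horizontal_frame mul w X"
    and "N = card (first_stratum w)" and "N \<ge> 2"
    and "test_function {x. proj1 w x \<noteq> 0} f"
  shows "(L2_norm (sub_laplacian w X f))\<^sup>2 \<ge>
      (\<alpha> * (real N - 2) - 2 * \<beta>) * (L2_norm (\<lambda>x. hgrad w X f x /\<^sub>R norm (proj1 w x)))\<^sup>2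
      - \<alpha>\<^sup>2 * (L2_norm (\<lambda>x. radial_hderiv w X f x /\<^sub>R (norm (proj1 w x))\<^sup>2))\<^sup>2
      + (\<alpha> * (real N - 4) * (real N - 2) - \<alpha>\<^sup>2 * (real N - 2) + 2 * \<beta> * (4 - real N)
          - \<beta>\<^sup>2 + \<alpha> * \<beta> * (real N - 2))
        * (L2_norm (\<lambda>x. f x /\<^sub>R (norm (proj1 w x))\<^sup>2))\<^sup>2"
proof -
  define \<sigma> where "\<sigma> x = (norm (proj1 w x))\<^sup>2" for x
  define u where "u = sub_laplacian w X f"
  define R where "R = radial_hderiv w X f"
  define U where "U x = u x \<bullet> u x" for x
  define A where "A x = (norm (hgrad w X f x))\<^sup>2 / \<sigma> x" for x
  define B where "B x = (R x \<bullet> R x) / (\<sigma> x)\<^sup>2" for x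
  define C where "C x = (f x \<bullet> f x) / (\<sigma> x)\<^sup>2" for x
  define F where "F x = (f x \<bullet> u x) / \<sigma> x" for x
  define E where "E x = (f x \<bullet> R x) / (\<sigma> x)\<^sup>2" for x
  note defs = \<sigma>_def u_def R_def U_def A_def B_def C_def F_def E_def
  have int: "integrable lborel U" "integrable lborel A" "integrable lborel B"
    "integrable lborel C" "integrable lborel F" "integrable lborel E"
    using integrable_quadratic_terms[OF assms(1,2,5)] unfolding defs[abs_def] by auto
  have "(LINT x|lborel. (real N - 4) * C x + 2 * E x) = 0"
    using integral_inner_radial[OF assms(1,2,5)] unfolding defs assms(3) .
  then have E: "2 * integral\<^sup>L lborel E = - (real N - 4) * integral\<^sup>L lborel C"
    using int by (simp add: algebra_simps)
  have "(LINT x|lborel. F x + A x - 2 * E x) = 0"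
    using integral_inner_sub_laplacian[OF assms(1,2,5)] unfolding defs .
  then have F: "integral\<^sup>L lborel F = 2 * integral\<^sup>L lborel E - integral\<^sup>L lborel A"
    using int by (simp add: algebra_simps)
  \<comment> \<open>The value of \<open>c\<close> makes the second operator the formal adjoint of the first: the
    divergence of \<open>x'/\<rho>\<^sup>2\<close> is \<open>(N - 2)/\<rho>\<^sup>2\<close>.\<close>
  define c where "c = \<beta> - \<alpha> * (real N - 2)"
  have "F x = (f x /\<^sub>R \<sigma> x) \<bullet> u x" "E x = (f x /\<^sub>R \<sigma> x) \<bullet> (R x /\<^sub>R \<sigma> x)"
    "B x = (R x /\<^sub>R \<sigma> x) \<bullet> (R x /\<^sub>R \<sigma> x)" "C x = (f x /\<^sub>R \<sigma> x) \<bullet> (f x /\<^sub>R \<sigma> x)" for x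
    by (simp_all only: F_def E_def B_def C_def inner_scaleR_left inner_scaleR_right divide_inverse
        power2_eq_square inverse_mult_distrib mult.commute mult.left_commute)
  then have "(\<beta> + c) * F x - \<alpha> * (\<beta> - c) * E x - \<alpha>\<^sup>2 * B x - (\<beta>\<^sup>2 + c\<^sup>2) / 2 * C x \<le> U x" for x
    using factorization_inequality[of \<beta> c "f x /\<^sub>R \<sigma> x" "u x" \<alpha> "R x /\<^sub>R \<sigma> x"]
    by (simp only: U_def)
  then have "(LINT x|lborel. (\<beta> + c) * F x - \<alpha> * (\<beta> - c) * E x - \<alpha>\<^sup>2 * B x
      - (\<beta>\<^sup>2 + c\<^sup>2) / 2 * C x) \<le> integral\<^sup>L lborel U"
    using int by (intro integral_mono) auto
  then have *: "(\<beta> + c) * integral\<^sup>L lborel F - \<alpha> * (\<beta> - c) * integral\<^sup>L lborel E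
      - \<alpha>\<^sup>2 * integral\<^sup>L lborel B - (\<beta>\<^sup>2 + c\<^sup>2) / 2 * integral\<^sup>L lborel C \<le> integral\<^sup>L lborel U"
    using int by simp
  have eq: "(\<beta> + c) * integral\<^sup>L lborel F - \<alpha> * (\<beta> - c) * integral\<^sup>L lborel E
      - \<alpha>\<^sup>2 * integral\<^sup>L lborel B - (\<beta>\<^sup>2 + c\<^sup>2) / 2 * integral\<^sup>L lborel C =
      (\<alpha> * (real N - 2) - 2 * \<beta>) * integral\<^sup>L lborel A - \<alpha>\<^sup>2 * integral\<^sup>L lborel B
      + (\<alpha> * (real N - 4) * (real N - 2) - \<alpha>\<^sup>2 * (real N - 2) + 2 * \<beta> * (4 - real N)
          - \<beta>\<^sup>2 + \<alpha> * \<beta> * (real N - 2)) * integral\<^sup>L lborel C"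
  proof -
    have E': "integral\<^sup>L lborel E = - (real N - 4) * integral\<^sup>L lborel C / 2"
      using E by simp
    show ?thesis
      unfolding F E' c_def by (simp add: field_simps power2_eq_square)
  qed
  have "(L2_norm u)\<^sup>2 = integral\<^sup>L lborel U"
    by (simp add: L2_norm_squared U_def[abs_def] power2_norm_eq_inner)
  moreover have "(L2_norm (\<lambda>x. hgrad w X f x /\<^sub>R norm (proj1 w x)))\<^sup>2 = integral\<^sup>L lborel A"
    by (simp add: L2_norm_squared A_def[abs_def] \<sigma>_def power_mult_distrib divide_inverse
        power_inverse mult.commute)
  moreover have "(L2_norm (\<lambda>x. R x /\<^sub>R (norm (proj1 w x))\<^sup>2))\<^sup>2 = integral\<^sup>L lborel B"
    by (simp add: L2_norm_squared B_def[abs_def] \<sigma>_def power_mult_distrib divide_inverse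
        power_inverse mult.commute power2_norm_eq_inner[symmetric])
  moreover have "(L2_norm (\<lambda>x. f x /\<^sub>R (norm (proj1 w x))\<^sup>2))\<^sup>2 = integral\<^sup>L lborel C"
    by (simp add: L2_norm_squared C_def[abs_def] \<sigma>_def power_mult_distrib divide_inverse
        power_inverse mult.commute power2_norm_eq_inner[symmetric])
  ultimately show ?thesis
    using * unfolding eq by (simp add: u_def R_def)
qed

end
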